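(* Let $(X,\|\cdot\|)$ be a Banach space over $\mathbb{K}\in\{\mathbb{R},\mathbb{C}\}$, let $m\in\mathbb{N}^+$, and let $T\in B(X)$ be an $(m,\infty)$-isometry. Then there exists a norm on $X$, equivalent to $\|\cdot\|$, under which $T$ is an isometry.
   Context: $\mathbb{N}^+$ denotes the positive integers and $B(X)$ the algebra of bounded linear operators on $X$. For $m\in\mathbb{N}^+$, an operator $T\in B(X)$ is an $(m,\infty)$-isometry if for all $x\in X$ $$\max_{\substack{k=0,\dots,m\\ k\text{ even}}}\|T^kx\|=\max_{\substack{k=0,\dots,m\\ k\text{ odd}}}\|T^kx\|.$$ Isometry under a norm $|\cdot|$ means $|Tx|=|x|$ for all $x\in X$. *)

theory Defs
  imports Complex_Main
begin

text \<open>
  The scalar field is one of \<open>\<real>\<close> and \<open>\<complex>\<close>. As the field has to be a type, the class below describes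
  the normed fields that are isometrically isomorphic to \<^typ>\<open>real\<close> or to \<^typ>\<open>complex\<close>, by means of
  an embedding into \<^typ>\<open>complex\<close>. Injectivity and preservation of \<open>1\<close> follow from the equation
  for the norm.
\<close>

class real_or_complex = real_normed_field +
  assumes real_or_complex_embedding:
    "\<exists>\<phi> :: 'a \<Rightarrow> complex.
       (\<forall>a b. \<phi> (a + b) = \<phi> a + \<phi> b) \<and> (\<forall>a b. \<phi> (a * b) = \<phi> a * \<phi> b) \<and>
       (\<forall>a. norm (\<phi> a) = norm a) \<and> (range \<phi> = \<real> \<or> range \<phi> = UNIV)"

instance real :: real_or_complex
proof
  show "\<exists>\<phi> :: real \<Rightarrow> complex.
       (\<forall>a b. \<phi> (a + b) = \<phi> a + \<phi> b) \<and> (\<forall>a b. \<phi> (a * b) = \<phi> a * \<phi> b) \<and>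
       (\<forall>a. norm (\<phi> a) = norm a) \<and> (range \<phi> = \<real> \<or> range \<phi> = UNIV)"
    by (rule exI[of _ complex_of_real]) (simp add: Reals_def)
qed

instance complex :: real_or_complex
proof
  show "\<exists>\<phi> :: complex \<Rightarrow> complex.
       (\<forall>a b. \<phi> (a + b) = \<phi> a + \<phi> b) \<and> (\<forall>a b. \<phi> (a * b) = \<phi> a * \<phi> b) \<and>
       (\<forall>a. norm (\<phi> a) = norm a) \<and> (range \<phi> = \<real> \<or> range \<phi> = UNIV)"
    by (rule exI[of _ "\<lambda>z. z"]) simp
qed

definition norm_over ::
    "('k::real_normed_field \<Rightarrow> 'a::ab_group_add \<Rightarrow> 'a) \<Rightarrow> ('a \<Rightarrow> real) \<Rightarrow> bool" where
  "norm_over scale N \<longleftrightarrow>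
     (\<forall>x. 0 \<le> N x) \<and> (\<forall>x. N x = 0 \<longleftrightarrow> x = 0) \<and>
     (\<forall>c x. N (scale c x) = norm c * N x) \<and>
     (\<forall>x y. N (x + y) \<le> N x + N y)"

text \<open>
  The type classes for normed spaces only provide real scalars. A normed space over \<open>'k\<close> is a
  type of class \<^class>\<open>real_normed_vector\<close> together with a scalar multiplication by \<open>'k\<close> that extends
  the real one and for which the norm of the class is a norm over \<open>'k\<close>. It is a
  Banach space if the type is of class \<^class>\<open>banach\<close>; completeness does not depend on the scalars.
\<close>

locale normed_space_over = vector_space scale
  for scale :: "'k::real_normed_field \<Rightarrow> 'a::real_normed_vector \<Rightarrow> 'a" +
  assumes scale_of_real: "scale (of_real r) x = r *\<^sub>R x"
    and norm_over_norm: "norm_over scale norm"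

lemma normed_space_over_scaleR:
  "normed_space_over (scaleR :: real \<Rightarrow> 'a::real_normed_vector \<Rightarrow> 'a)"
  by unfold_locales (auto simp: norm_over_def algebra_simps norm_triangle_ineq)

definition bounded_operators ::
    "('k::real_normed_field \<Rightarrow> 'a::real_normed_vector \<Rightarrow> 'a) \<Rightarrow> ('a \<Rightarrow> 'a) set" where
  "bounded_operators scale = {T. Vector_Spaces.linear scale scale T \<and> bounded_linear T}"

definition m_inf_isometry :: "nat \<Rightarrow> ('a::real_normed_vector \<Rightarrow> 'a) \<Rightarrow> bool" where
  "m_inf_isometry m T \<longleftrightarrow>
     (\<forall>x. Max ((\<lambda>k. norm ((T ^^ k) x)) ` {k \<in> {0..m}. even k}) =
          Max ((\<lambda>k. norm ((T ^^ k) x)) ` {k \<in> {0..m}. odd k}))"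

definition equivalent_norms :: "('a \<Rightarrow> real) \<Rightarrow> ('a \<Rightarrow> real) \<Rightarrow> bool" where
  "equivalent_norms N N' \<longleftrightarrow> (\<exists>a > 0. \<exists>b > 0. \<forall>x. a * N' x \<le> N x \<and> N x \<le> b * N' x)"

definition isometry_under :: "('a \<Rightarrow> real) \<Rightarrow> ('a \<Rightarrow> 'a) \<Rightarrow> bool" where
  "isometry_under N T \<longleftrightarrow> (\<forall>x. N (T x) = N x)"

end

theory Submission
  imports Defs
begin

text \<open>
  The norm is \<open>N x = max\<^bsub>k < m\<^esub> \<parallel>T\<^sup>k x\<parallel>\<close>. Put \<open>a k = \<parallel>T\<^sup>k x\<parallel>\<close>. The hypothesis on \<open>T\<close> says that the
  maximum of \<open>a\<close> over \<open>0, \<dots>, m\<close> is attained at an even index and also at an odd one, so at two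
  different indices. Discarding a single index therefore does not lower the maximum. Discarding \<open>m\<close>
  leaves \<open>N x\<close>, and discarding \<open>0\<close> leaves \<open>N (T x)\<close>, so these agree
  (\<open>Max_omit_last_eq_Max_omit_first\<close>).

  That \<open>N\<close> is a norm holds for any finite maximum of norms of linear images
  in which one of the linear maps is injective (\<open>norm_over_Max_linear_images\<close>); here \<open>T\<^sup>0\<close> is the
  identity. The index \<open>0\<close> also gives \<open>\<parallel>x\<parallel> \<le> N x\<close>, and boundedness of the powers of \<open>T\<close> gives the
  reverse estimate.
\<close>

lemma norm_over_Max_linear_images:
  fixes scale :: "'k::real_normed_field \<Rightarrow> 'a::ab_group_add \<Rightarrow> 'a"
  assumes N: "norm_over scale N"
    and I: "finite I"
    and lin: "\<And>i. i \<in> I \<Longrightarrow> Vector_Spaces.linear scale scale (S i)"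
    and j: "j \<in> I" "\<And>x. S j x = 0 \<Longrightarrow> x = 0"
  shows "norm_over scale (\<lambda>x. Max ((\<lambda>i. N (S i x)) ` I))"
proof -
  let ?M = "\<lambda>x. Max ((\<lambda>i. N (S i x)) ` I)"
  have ne: "I \<noteq> {}" using j(1) by auto
  have N_ge: "0 \<le> N x" and N_0: "N x = 0 \<longleftrightarrow> x = 0"
    and N_scale: "N (scale c x) = norm c * N x" and N_add: "N (x + y) \<le> N x + N y" for c x y
    using N unfolding norm_over_def by auto
  have S_add: "S i (x + y) = S i x + S i y" and S_scale: "S i (scale c x) = scale c (S i x)"
    if "i \<in> I" for i c x y
    using lin[OF that]
    by (simp_all add: Vector_Spaces.linear_def module_hom_def module_hom_axioms_def)
  have S_0: "S i 0 = 0" if "i \<in> I" for i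
    using S_add[OF that, of 0 0] by simp
  have upper: "N (S i x) \<le> ?M x" if "i \<in> I" for i x
    using that I by (intro Max_ge) auto
  have least: "?M x \<le> b" if "\<And>i. i \<in> I \<Longrightarrow> N (S i x) \<le> b" for x b
    using that I ne by (subst Max_le_iff) auto
  have ge: "0 \<le> ?M x" for x
    using upper[OF j(1), of x] N_ge[of "S j x"] by linarith
  have zero: "?M x = 0 \<longleftrightarrow> x = 0" for x
  proof
    assume "?M x = 0"
    then have "N (S j x) = 0"
      using upper[OF j(1), of x] N_ge[of "S j x"] by linarith
    then show "x = 0" using N_0 j(2) by blast
  next
    assume "x = 0"
    then have "?M x \<le> 0" by (intro least) (simp add: S_0 N_0[THEN iffD2])
    then show "?M x = 0" using ge[of x] by linarith
  qed
  have scale: "?M (scale c x) = norm c * ?M x" for c x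
  proof -
    have "mono ((*) (norm c))" by (simp add: mono_def mult_left_mono)
    then have "norm c * ?M x = Max ((*) (norm c) ` (\<lambda>i. N (S i x)) ` I)"
      using I ne by (intro mono_Max_commute) auto
    also have "(*) (norm c) ` (\<lambda>i. N (S i x)) ` I = (\<lambda>i. N (S i (scale c x))) ` I"
      by (auto simp: image_image S_scale N_scale intro!: image_cong)
    finally show ?thesis by simp
  qed
  have add: "?M (x + y) \<le> ?M x + ?M y" for x y
  proof (rule least)
    fix i assume "i \<in> I"
    then show "N (S i (x + y)) \<le> ?M x + ?M y"
      using S_add N_add[of "S i x" "S i y"] upper[of i x] upper[of i y] by force
  qed
  show ?thesis
    unfolding norm_over_def using ge zero scale add by blast
qed

text \<open>
  A maximum attained at indices of both parities is attained at two different indices, so one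
  of them survives when an index is discarded.
\<close>

lemma Max_omit_index:
  fixes a :: "nat \<Rightarrow> 'b::linorder"
  assumes "finite I" and "j \<in> I"
    and ne: "{k \<in> I. even k} \<noteq> {}" "{k \<in> I. odd k} \<noteq> {}"
    and eq: "Max (a ` {k \<in> I. even k}) = Max (a ` {k \<in> I. odd k})"
  shows "Max (a ` (I - {j})) = Max (a ` I)"
proof -
  let ?E = "{k \<in> I. even k}" and ?O = "{k \<in> I. odd k}"
  have fin: "finite ?E" "finite ?O" using \<open>finite I\<close> by auto
  have "Max (a ` ?E) \<in> a ` ?E" using fin(1) ne(1) by (intro Max_in) auto
  then obtain p where p: "p \<in> I" "even p" "a p = Max (a ` ?E)" by auto
  have "Max (a ` ?O) \<in> a ` ?O" using fin(2) ne(2) by (intro Max_in) auto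
  then obtain q where q: "q \<in> I" "odd q" "a q = Max (a ` ?O)" by auto
  have bound: "a k \<le> a p" if "k \<in> I" for k
  proof (cases "even k")
    case True
    then show ?thesis using that fin p by auto
  next
    case False
    then show ?thesis using that fin p eq by auto
  qed
  define r where "r = (if j = p then q else p)"
  have r: "r \<in> I - {j}" "a r = a p"
    using p q eq by (auto simp: r_def)
  have "Max (a ` (I - {j})) = a p"
    using \<open>finite I\<close> bound r by (intro Max_eqI) (auto intro: rev_image_eqI)
  moreover have "Max (a ` I) = a p"
    using \<open>finite I\<close> bound p(1) by (intro Max_eqI) blast+
  ultimately show ?thesis by simp
qed

lemma Max_omit_last_eq_Max_omit_first:
  fixes a :: "nat \<Rightarrow> 'b::linorder"
  assumes "m > 0"
    and "Max (a ` {k \<in> {0..m}. even k}) = Max (a ` {k \<in> {0..m}. odd k})"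
  shows "Max (a ` {..<m}) = Max ((\<lambda>k. a (Suc k)) ` {..<m})"
proof -
  have ne: "{k \<in> {0..m}. even k} \<noteq> {}" "{k \<in> {0..m}. odd k} \<noteq> {}"
    using \<open>m > 0\<close> by (auto intro: exI[of _ 0] exI[of _ 1])
  have "Max (a ` ({0..m} - {m})) = Max (a ` ({0..m} - {0}))"
    using Max_omit_index[of "{0..m}" m a] Max_omit_index[of "{0..m}" 0 a] ne assms(2) by simp
  moreover have "{0..m} - {m} = {..<m}" by auto
  moreover have "{0..m} - {0} = Suc ` {..<m}"
    by (auto simp: lessThan_atLeast0 atLeastLessThanSuc_atLeastAtMost)
  ultimately show ?thesis by (simp add: image_image)
qed

lemma bounded_linear_funpow:
  fixes T :: "'a::real_normed_vector \<Rightarrow> 'a"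
  assumes "bounded_linear T"
  shows "bounded_linear (T ^^ k)"
proof (induction k)
  case 0
  have "T ^^ 0 = (\<lambda>x. x)" by (simp add: fun_eq_iff)
  then show ?case by (simp only: bounded_linear_ident)
next
  case (Suc k)
  then show ?case using bounded_linear_compose[OF assms] by (simp add: comp_def)
qed

lemma (in vector_space) linear_funpow:
  assumes "Vector_Spaces.linear scale scale T"
  shows "Vector_Spaces.linear scale scale (T ^^ k)"
proof (induction k)
  case 0
  have "T ^^ 0 = id" by simp
  then show ?case using linear_id by (simp only:)
next
  case (Suc k)
  then show ?case using Vector_Spaces.linear_compose[OF _ assms] by (simp only: funpow.simps)
qed

lemma equivalent_norms_Max_bounded_images:
  fixes S :: "'i \<Rightarrow> 'a::real_normed_vector \<Rightarrow> 'a"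
  assumes "finite I" and "\<And>i. i \<in> I \<Longrightarrow> bounded_linear (S i)"
    and "j \<in> I" and "S j = id"
  shows "equivalent_norms (\<lambda>x. Max ((\<lambda>i. norm (S i x)) ` I)) norm"
proof -
  have "\<forall>i\<in>I. \<exists>K>0. \<forall>x. norm (S i x) \<le> norm x * K"
    using assms(2) bounded_linear.pos_bounded by blast
  then obtain K where K: "\<And>i. i \<in> I \<Longrightarrow> 0 < K i" "\<And>i x. i \<in> I \<Longrightarrow> norm (S i x) \<le> norm x * K i"
    by metis
  have "norm (S i x) \<le> sum K I * norm x" if "i \<in> I" for i x
  proof -
    have "K i \<le> sum K I"
      using that K(1) \<open>finite I\<close> by (intro member_le_sum) (auto intro: less_imp_le)
    then show ?thesis
      using K(2)[OF that, of x] mult_right_mono[of "K i" "sum K I" "norm x"]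
      by (simp add: mult.commute)
  qed
  then have upper: "Max ((\<lambda>i. norm (S i x)) ` I) \<le> sum K I * norm x" for x
    using assms by (subst Max_le_iff) auto
  have lower: "1 * norm x \<le> Max ((\<lambda>i. norm (S i x)) ` I)" for x
    using assms by (intro Max_ge) (auto intro!: rev_image_eqI[of j])
  have "0 < sum K I" using K(1) assms by (intro sum_pos) auto
  then show ?thesis
    unfolding equivalent_norms_def using upper lower zero_less_one by blast
qed

theorem theorem5p2:
  fixes scale :: "'k::real_or_complex \<Rightarrow> 'a::banach \<Rightarrow> 'a"
    and T :: "'a \<Rightarrow> 'a" and m :: nat
  assumes "normed_space_over scale"
    and "m > 0"
    and "T \<in> bounded_operators scale"
    and "m_inf_isometry m T"
  shows "\<exists>N. norm_over scale N \<and> equivalent_norms N norm \<and> isometry_under N T"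
proof -
  interpret normed_space_over scale by fact
  define N where "N = (\<lambda>x. Max ((\<lambda>k. norm ((T ^^ k) x)) ` {..<m}))"
  have lin: "Vector_Spaces.linear scale scale T" and bdd: "bounded_linear T"
    using assms(3) by (auto simp: bounded_operators_def)
  have "norm_over scale N"
    unfolding N_def
    using norm_over_norm linear_funpow[OF lin] \<open>m > 0\<close>
    by (intro norm_over_Max_linear_images[where j = 0]) auto
  moreover have "equivalent_norms N norm"
    unfolding N_def
    using bounded_linear_funpow[OF bdd] \<open>m > 0\<close>
    by (intro equivalent_norms_Max_bounded_images[where j = 0]) auto
  moreover have "isometry_under N T"
    unfolding isometry_under_def
  proof
    fix x
    have "N (T x) = Max ((\<lambda>k. norm ((T ^^ Suc k) x)) ` {..<m})"
      by (simp add: N_def funpow_swap1)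
    also have "\<dots> = N x"
      unfolding N_def
      using Max_omit_last_eq_Max_omit_first[of m "\<lambda>k. norm ((T ^^ k) x)"] assms(2,4)
      by (simp add: m_inf_isometry_def)
    finally show "N (T x) = N x" .
  qed
  ultimately show ?thesis by blast
qed

end
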